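(* Let the number of variables $n$ be even, let $\Gamma\subseteq\{1,-1\}^n$ with $|\Gamma|=2^{n-1}$, and let $C_{n,2d}(\Gamma)=\{p\in C_{n,2d} : p(\mathbf{s})=0\text{ for all }\mathbf{s}\in\Gamma\}$. Then $$\dim(C_{n,2d}(\Gamma))\le\sum_{i=0}^{d}\binom{n+2i-1}{2i}.$$
   Context: $\mathbb{N}=\{0,1,2,\dots\}$; $n,d\ge 1$. A circuit polynomial is a polynomial $f(\mathbf{x})=\sum_{j=0}^r f_{\boldsymbol{\alpha}(j)}\mathbf{x}^{\boldsymbol{\alpha}(j)}+f_{\boldsymbol{\beta}}\mathbf{x}^{\boldsymbol{\beta}}\in\mathbb{R}[x_1,\dots,x_n]$ with $r\le n$, $f_{\boldsymbol{\alpha}(j)}>0$, $f_{\boldsymbol{\beta}}\in\mathbb{R}$, such that the Newton polytope of $f$ (convex hull of the exponents with nonzero coefficient) is a simplex with vertices $\boldsymbol{\alpha}(0),\dots,\boldsymbol{\alpha}(r)\in(2\mathbb{N})^n$ and $\boldsymbol{\beta}\in\mathbb{N}^n$ is written uniquely as $\boldsymbol{\beta}=\sum_{j=0}^r\lambda_j\boldsymbol{\alpha}(j)$ with $\lambda_j>0$, $\sum_j\lambda_j=1$. $C_{n,2d}$ is the cone of all finite sums $\sum_i\mu_i f_i$ of degree at most $2d$ with $\mu_i\ge 0$ and $f_i$ nonnegative circuit polynomials. $\dim$ of a face means the dimension of its affine hull. *)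

theory Defs
  imports "HOL-Analysis.Analysis" "HOL-Analysis.Finite_Function_Topology"
begin

text \<open>Real polynomials in the variables $x_i$ ($i$ ranging over the finite type \<open>'n\<close>, so that
  $n$ is \<open>CARD('n)\<close>) are the finitely supported maps from exponent vectors to coefficients.\<close>

type_synonym 'n mpoly = "(nat ^ 'n) \<Rightarrow>\<^sub>0 real"

definition mpoly_eval :: "'n::finite mpoly \<Rightarrow> real ^ 'n \<Rightarrow> real" where
  "mpoly_eval f x = (\<Sum>a\<in>Poly_Mapping.keys f. Poly_Mapping.lookup f a * (\<Prod>i\<in>UNIV. x $ i ^ (a $ i)))"

definition degree_le :: "nat \<Rightarrow> 'n::finite mpoly set" where
  "degree_le k = {f. \<forall>a\<in>Poly_Mapping.keys f. (\<Sum>i\<in>UNIV. a $ i) \<le> k}"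

definition real_exponent :: "nat ^ 'n \<Rightarrow> real ^ 'n" where
  "real_exponent a = (\<chi> i. real (a $ i))"

definition newton_polytope :: "'n::finite mpoly \<Rightarrow> (real ^ 'n) set" where
  "newton_polytope f = convex hull (real_exponent ` Poly_Mapping.keys f)"

text \<open>The coefficient \<open>b\<close> may be zero. For \<open>r = 0\<close> the conditions force \<open>\<beta> = \<alpha> 0\<close>, so that the two
  coefficients add up. The weights \<open>l\<close> are taken in the extensional function space only so that
  their values outside \<open>{..r}\<close> do not interfere with uniqueness.\<close>

definition circuit_polynomial :: "'n::finite mpoly \<Rightarrow> bool" where
  "circuit_polynomial f \<longleftrightarrow>
    (\<exists>(r::nat) (\<alpha> :: nat \<Rightarrow> nat ^ 'n) (c :: nat \<Rightarrow> real) (\<beta> :: nat ^ 'n) (b :: real).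
      r \<le> CARD('n) \<and>
      (\<forall>j\<le>r. 0 < c j) \<and>
      f = (\<Sum>j\<le>r. Poly_Mapping.single (\<alpha> j) (c j)) + Poly_Mapping.single \<beta> b \<and>
      int r simplex newton_polytope f \<and>
      {v. v extreme_point_of newton_polytope f} = (\<lambda>j. real_exponent (\<alpha> j)) ` {..r} \<and>
      (\<forall>j\<le>r. \<forall>i. even (\<alpha> j $ i)) \<and>
      (\<exists>!l. l \<in> {..r} \<rightarrow>\<^sub>E {0<..} \<and> (\<Sum>j\<le>r. l j) = 1 \<and>
            real_exponent \<beta> = (\<Sum>j\<le>r. l j *\<^sub>R real_exponent (\<alpha> j))))"

definition nonneg_circuit :: "'n::finite mpoly \<Rightarrow> bool" where
  "nonneg_circuit f \<longleftrightarrow> circuit_polynomial f \<and> (\<forall>x. 0 \<le> mpoly_eval f x)"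

text \<open>The degree bound is imposed on the sum, not on the individual summands.\<close>

definition sonc_cone :: "nat \<Rightarrow> 'n::finite mpoly set" where
  "sonc_cone k = {p \<in> degree_le k. \<exists>(m::nat) (\<mu> :: nat \<Rightarrow> real) (f :: nat \<Rightarrow> 'n mpoly).
      (\<forall>i<m. 0 \<le> \<mu> i \<and> nonneg_circuit (f i)) \<and> p = (\<Sum>i<m. \<mu> i *\<^sub>R f i)}"

definition sonc_face :: "nat \<Rightarrow> (real ^ 'n) set \<Rightarrow> 'n::finite mpoly set" where
  "sonc_face k \<Gamma> = {p \<in> sonc_cone k. \<forall>s\<in>\<Gamma>. mpoly_eval p s = 0}"

text \<open>The library constant \<open>aff_dim\<close> is restricted to Euclidean spaces, so the dimension of the affine
  hull is taken as the dimension of its direction space. The constant \<open>dim\<close> is meaningful only for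
  finite-dimensional spans; subsets of \<open>degree_le k\<close> have one, being spanned by finitely many
  monomials.\<close>

definition affine_hull_dim :: "'a::real_vector set \<Rightarrow> nat" where
  "affine_hull_dim S = dim {x - y | x y. x \<in> affine hull S \<and> y \<in> affine hull S}"

end

theory Submission
  imports Defs
begin

text \<open>A nonnegative circuit polynomial vanishing at sign vectors \<open>s\<close> satisfies
  \<open>\<Sum>c\<^sub>j + b s\<^sup>\<beta> = 0\<close> there, so \<open>s\<^sup>\<beta>\<close> is constant on \<open>\<Gamma>\<close>; the same is trivially true
  of the even exponents. Hence every monomial of a polynomial in the face is constant on \<open>\<Gamma>\<close>.
  As \<open>\<Gamma>\<close> contains half of all sign vectors, an exponent that is not even and whose monomial is constant on
  \<open>\<Gamma>\<close> determines \<open>\<Gamma>\<close> up to the sign, so these exponents form a single class modulo 2. If this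
  class has odd total degree, then, the number of variables being even, some coordinate is
  even throughout it, and raising that coordinate by one maps the class injectively to exponents of even
  total degree at most \<open>2d\<close> that are not even. So there are at most as many admissible monomials as
  monomials of even degree at most \<open>2d\<close>.\<close>

section \<open>Evaluation of polynomials\<close>

definition monom_eval :: "real ^ 'n::finite \<Rightarrow> nat ^ 'n \<Rightarrow> real" where
  "monom_eval x a = (\<Prod>i\<in>UNIV. x $ i ^ (a $ i))"

lemma mpoly_eval_superset:
  assumes "finite A" "Poly_Mapping.keys f \<subseteq> A"
  shows "mpoly_eval f x = (\<Sum>a\<in>A. Poly_Mapping.lookup f a * monom_eval x a)"
  unfolding mpoly_eval_def monom_eval_def
  by (intro sum.mono_neutral_left) (use assms in \<open>auto simp: in_keys_iff\<close>)

lemma mpoly_eval_0 [simp]: "mpoly_eval 0 x = 0"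
  by (simp add: mpoly_eval_def)

lemma mpoly_eval_add: "mpoly_eval (f + g) x = mpoly_eval f x + mpoly_eval g x"
proof -
  let ?A = "Poly_Mapping.keys f \<union> Poly_Mapping.keys g"
  have "Poly_Mapping.keys (f + g) \<subseteq> ?A"
    by (rule Poly_Mapping.keys_add)
  then show ?thesis
    by (simp add: mpoly_eval_superset[of ?A] lookup_add sum.distrib distrib_right)
qed

lemma lookup_scaleR [simp]:
  fixes f :: "'a \<Rightarrow>\<^sub>0 real"
  shows "Poly_Mapping.lookup (c *\<^sub>R f) a = c * Poly_Mapping.lookup f a"
  by (simp add: scaleR_poly_mapping_def)

lemma mpoly_eval_scaleR: "mpoly_eval (c *\<^sub>R f) x = c * mpoly_eval f x"
proof -
  have "Poly_Mapping.keys (c *\<^sub>R f) \<subseteq> Poly_Mapping.keys f"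
    by (auto simp: in_keys_iff)
  then show ?thesis
    by (simp add: mpoly_eval_superset[of "Poly_Mapping.keys f"] sum_distrib_left mult.assoc)
qed

lemma mpoly_eval_sum: "mpoly_eval (\<Sum>i\<in>I. f i) x = (\<Sum>i\<in>I. mpoly_eval (f i) x)"
  by (induction I rule: infinite_finite_induct) (auto simp: mpoly_eval_add)

lemma mpoly_eval_single: "mpoly_eval (Poly_Mapping.single a c) x = c * monom_eval x a"
  by (simp add: mpoly_eval_superset[of "{a}"])

section \<open>Monomials on sign vectors\<close>

definition sign_vectors :: "(real ^ 'n) set" where
  "sign_vectors = {s. \<forall>i. s $ i \<in> {1, -1}}"

definition flip :: "'n \<Rightarrow> real ^ 'n \<Rightarrow> real ^ 'n" where
  "flip k s = (\<chi> i. if i = k then - s $ i else s $ i)"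

lemma flip_flip [simp]: "flip k (flip k s) = s"
  by (simp add: flip_def vec_eq_iff)

lemma flip_in_sign_vectors: "s \<in> sign_vectors \<Longrightarrow> flip k s \<in> sign_vectors"
  by (auto simp: flip_def sign_vectors_def)

lemma monom_eval_flip: "monom_eval (flip k s) a = (-1) ^ (a $ k) * monom_eval s a"
proof -
  have "monom_eval (flip k s) a = (- s $ k) ^ (a $ k) * (\<Prod>i\<in>UNIV - {k}. s $ i ^ (a $ i))"
    unfolding monom_eval_def by (subst prod.remove[of _ k]) (auto simp: flip_def)
  also have "\<dots> = (-1) ^ (a $ k) * monom_eval s a"
    unfolding monom_eval_def
    by (subst prod.remove[of UNIV k]) (auto simp: power_minus[of "s $ k"])
  finally show ?thesis .
qed

lemma monom_eval_sign_nonzero: "s \<in> sign_vectors \<Longrightarrow> monom_eval s a \<noteq> 0"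
  by (auto simp: monom_eval_def sign_vectors_def) (metis one_neq_zero zero_neq_neg_one)

lemma monom_eval_sign_even:
  assumes "s \<in> sign_vectors" "\<And>i. even (a $ i)"
  shows "monom_eval s a = 1"
proof -
  have "s $ i ^ (a $ i) = 1" for i
  proof -
    have "s $ i = 1 \<or> s $ i = -1"
      using assms(1) by (auto simp: sign_vectors_def)
    then show ?thesis
      using assms(2)[of i] by auto
  qed
  then show ?thesis
    by (simp add: monom_eval_def)
qed

lemma sign_vectors_subset: "sign_vectors \<subseteq> vec_lambda ` (UNIV \<rightarrow>\<^sub>E {1, -1})"
proof
  fix s :: "real ^ 'a"
  assume "s \<in> sign_vectors"
  then have "($) s \<in> UNIV \<rightarrow>\<^sub>E {1, -1}"
    by (auto simp: sign_vectors_def)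
  then show "s \<in> vec_lambda ` (UNIV \<rightarrow>\<^sub>E {1, -1})"
    by (metis image_eqI vec_nth_inverse)
qed

lemma finite_sign_vectors: "finite (sign_vectors :: (real ^ 'n::finite) set)"
  by (rule finite_subset[OF sign_vectors_subset]) (intro finite_imageI finite_PiE; simp)

lemma card_sign_vectors_le: "card (sign_vectors :: (real ^ 'n::finite) set) \<le> 2 ^ CARD('n)"
proof -
  let ?P = "(UNIV :: 'n set) \<rightarrow>\<^sub>E {1, -1 :: real}"
  have fin: "finite ?P"
    by (intro finite_PiE) auto
  have "card (sign_vectors :: (real ^ 'n) set) \<le> card (vec_lambda ` ?P)"
    by (intro card_mono sign_vectors_subset finite_imageI fin)
  also have "\<dots> \<le> card ?P"
    by (rule card_image_le[OF fin])
  also have "\<dots> = 2 ^ CARD('n)"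
    by (simp add: card_PiE numeral_2_eq_2)
  finally show ?thesis .
qed

section \<open>Exponents whose monomials are constant on half of the sign vectors\<close>

definition const_exponents :: "(real ^ 'n::finite) set \<Rightarrow> (nat ^ 'n) set" where
  "const_exponents \<Gamma> = {a. \<exists>e. \<forall>s\<in>\<Gamma>. monom_eval s a = e}"

lemma const_exponentsD:
  "a \<in> const_exponents \<Gamma> \<Longrightarrow> s \<in> \<Gamma> \<Longrightarrow> t \<in> \<Gamma> \<Longrightarrow> monom_eval s a = monom_eval t a"
  by (auto simp: const_exponents_def)

locale half_sign_vectors =
  fixes \<Gamma> :: "(real ^ 'n::finite) set"
  assumes sub: "\<Gamma> \<subseteq> sign_vectors"
    and card: "card \<Gamma> = 2 ^ (CARD('n) - 1)"
begin

lemma nonempty: "\<Gamma> \<noteq> {}"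
  using card by auto

text \<open>Flipping the odd coordinate \<open>i\<close> negates the monomial, so \<Gamma> and its
  flipped copy are disjoint. Each contains half of the sign vectors, so together they are all of
  them, and \<open>t\<close> has the wrong value for the flipped copy.\<close>

lemma level_set:
  assumes a: "a \<in> const_exponents \<Gamma>" "odd (a $ i)"
    and s: "s \<in> \<Gamma>" and t: "t \<in> sign_vectors" "monom_eval t a = monom_eval s a"
  shows "t \<in> \<Gamma>"
proof -
  have fin: "finite \<Gamma>"
    using sub finite_sign_vectors finite_subset by blast
  have neg: "monom_eval u a = - monom_eval s a" if u: "u \<in> flip i ` \<Gamma>" for u
  proof -
    obtain v where v: "v \<in> \<Gamma>" "u = flip i v"
      using u by blast
    have "monom_eval u a = - monom_eval v a"
      using a(2) by (simp add: v(2) monom_eval_flip)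
    also have "monom_eval v a = monom_eval s a"
      by (rule const_exponentsD[OF a(1) v(1) s])
    finally show ?thesis .
  qed
  have nz: "monom_eval s a \<noteq> 0"
    using s sub monom_eval_sign_nonzero by blast
  have disj: "\<Gamma> \<inter> flip i ` \<Gamma> = {}"
  proof -
    have False if "u \<in> \<Gamma>" "u \<in> flip i ` \<Gamma>" for u
      using const_exponentsD[OF a(1) that(1) s] neg[OF that(2)] nz by simp
    then show ?thesis by blast
  qed
  have "inj (flip i)"
    by (metis flip_flip injI)
  then have "card (\<Gamma> \<union> flip i ` \<Gamma>) = 2 * card \<Gamma>"
    using fin disj by (simp add: card_Un_disjoint card_image inj_on_subset)
  \<comment> \<open>There is at least one variable, so the truncated subtraction in the exponent is
    exact.\<close>
  also have "\<dots> = 2 ^ CARD('n)"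
    unfolding card by (simp flip: power_Suc)
  finally have "card (sign_vectors :: (real ^ 'n) set) \<le> card (\<Gamma> \<union> flip i ` \<Gamma>)"
    using card_sign_vectors_le by simp
  moreover have "\<Gamma> \<union> flip i ` \<Gamma> \<subseteq> sign_vectors"
    using sub flip_in_sign_vectors by blast
  ultimately have "\<Gamma> \<union> flip i ` \<Gamma> = sign_vectors"
    by (intro card_seteq finite_sign_vectors)
  then show ?thesis
    using t neg[of t] nz by force
qed

text \<open>If \<open>a $ k\<close> were even, flipping coordinate \<open>k\<close> would preserve
  the monomial of \<open>a\<close> and so, by \<open>level_set\<close>, stay inside \<Gamma>, yet it
  negates the monomial of \<open>b\<close>. By symmetry, all exponents here that are not even agree
  modulo 2.\<close>

lemma odd_transfer:
  assumes "a \<in> const_exponents \<Gamma>" "odd (a $ i)" "b \<in> const_exponents \<Gamma>" "odd (b $ k)"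
  shows "odd (a $ k)"
proof
  assume ev: "even (a $ k)"
  obtain s where s: "s \<in> \<Gamma>"
    using nonempty by blast
  then have "flip k s \<in> \<Gamma>"
    using ev sub by (intro level_set[OF assms(1,2) s]) (auto simp: monom_eval_flip flip_in_sign_vectors)
  then have "monom_eval (flip k s) b = monom_eval s b"
    using const_exponentsD assms(3) s by blast
  moreover have "monom_eval s b \<noteq> 0"
    using s sub monom_eval_sign_nonzero by blast
  ultimately show False
    using assms(4) by (simp add: monom_eval_flip)
qed

lemma even_in_const_exponents: "(\<And>i. even (a $ i)) \<Longrightarrow> a \<in> const_exponents \<Gamma>"
  using sub monom_eval_sign_even unfolding const_exponents_def by blast

text \<open>At sign vectors the even monomials equal 1, so a zero there fixes the value of the
  remaining term.\<close>

lemma keys_circuit: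
  assumes "circuit_polynomial f" "\<And>s. s \<in> \<Gamma> \<Longrightarrow> mpoly_eval f s = 0"
  shows "Poly_Mapping.keys f \<subseteq> const_exponents \<Gamma>"
proof -
  obtain r \<alpha> c \<beta> b where c: "\<forall>j\<le>r. 0 < c j"
    and f: "f = (\<Sum>j\<le>r. Poly_Mapping.single (\<alpha> j) (c j)) + Poly_Mapping.single \<beta> b"
    and ev: "\<forall>j\<le>(r::nat). \<forall>i. even (\<alpha> j $ i)"
    using assms(1) unfolding circuit_polynomial_def by blast
  have \<alpha>: "\<alpha> j \<in> const_exponents \<Gamma>" if "j \<le> r" for j
    using even_in_const_exponents ev that by blast
  have "monom_eval s \<beta> = - (\<Sum>j\<le>r. c j) / b" if s: "s \<in> \<Gamma>" for s
  proof -
    have "0 = (\<Sum>j\<le>r. c j * monom_eval s (\<alpha> j)) + b * monom_eval s \<beta>"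
      using assms(2)[OF s] by (simp add: f mpoly_eval_add mpoly_eval_sum mpoly_eval_single)
    also have "(\<Sum>j\<le>r. c j * monom_eval s (\<alpha> j)) = (\<Sum>j\<le>r. c j)"
      using s sub ev by (intro sum.cong) (auto simp: monom_eval_sign_even)
    finally have "b * monom_eval s \<beta> = - (\<Sum>j\<le>r. c j)"
      by simp
    \<comment> \<open>Positivity rules out \<open>b = 0\<close>, so the division below is a genuine
      one.\<close>
    moreover have "0 < (\<Sum>j\<le>r. c j)"
      using c by (intro sum_pos) auto
    ultimately show ?thesis
      by (metis mult_zero_left neg_equal_0_iff_equal nonzero_mult_div_cancel_left order_less_irrefl)
  qed
  then have \<beta>: "\<beta> \<in> const_exponents \<Gamma>"
    by (auto simp: const_exponents_def)
  let ?g = "\<lambda>j. Poly_Mapping.single (\<alpha> j) (c j)"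
  have "Poly_Mapping.keys f \<subseteq>
      Poly_Mapping.keys (\<Sum>j\<le>r. ?g j) \<union> Poly_Mapping.keys (Poly_Mapping.single \<beta> b)"
    unfolding f by (rule Poly_Mapping.keys_add)
  also have "\<dots> \<subseteq> (\<Union>j\<le>r. Poly_Mapping.keys (?g j)) \<union> {\<beta>}"
    by (intro Un_mono keys_sum) simp
  also have "\<dots> \<subseteq> const_exponents \<Gamma>"
    using \<alpha> \<beta> by (auto split: if_splits)
  finally show ?thesis .
qed

text \<open>Nonnegative summands with total 0 at a point of \<Gamma> all vanish there. Those of
  nonzero weight fall under \<open>keys_circuit\<close>; the others contribute no keys.\<close>

lemma keys_face:
  assumes "p \<in> sonc_face k \<Gamma>"
  shows "Poly_Mapping.keys p \<subseteq> const_exponents \<Gamma> \<inter> {a. (\<Sum>i\<in>UNIV. a $ i) \<le> k}"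
proof -
  obtain m \<mu> f where deg: "p \<in> degree_le k"
    and \<mu>: "\<And>i. i < m \<Longrightarrow> 0 \<le> \<mu> i" and f: "\<And>i. i < m \<Longrightarrow> nonneg_circuit (f i)"
    and p: "p = (\<Sum>i<(m::nat). \<mu> i *\<^sub>R f i)"
    using assms unfolding sonc_face_def sonc_cone_def by blast
  have zero: "\<mu> i * mpoly_eval (f i) s = 0" if i: "i < m" and s: "s \<in> \<Gamma>" for i s
  proof -
    have "(\<Sum>i<m. \<mu> i * mpoly_eval (f i) s) = 0"
      using assms s unfolding sonc_face_def p by (simp add: mpoly_eval_sum mpoly_eval_scaleR)
    then show ?thesis
      using \<mu> f i by (subst (asm) sum_nonneg_eq_0_iff) (auto simp: nonneg_circuit_def)
  qed
  have "Poly_Mapping.keys (\<mu> i *\<^sub>R f i) \<subseteq> const_exponents \<Gamma>" if i: "i < m" for i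
  proof (cases "\<mu> i = 0")
    case False
    then have "Poly_Mapping.keys (f i) \<subseteq> const_exponents \<Gamma>"
      using zero[OF i] f[OF i] by (intro keys_circuit) (auto simp: nonneg_circuit_def)
    then show ?thesis
      by (auto simp: in_keys_iff subset_iff)
  qed auto
  then have "Poly_Mapping.keys p \<subseteq> const_exponents \<Gamma>"
    unfolding p using keys_sum[of "\<lambda>i. \<mu> i *\<^sub>R f i" "{..<m}"] by fastforce
  then show ?thesis
    using deg by (auto simp: degree_le_def)
qed

end

section \<open>Counting exponents\<close>

text \<open>Listing the variables in some order turns exponent vectors into lists of fixed length
  and sum, which stars and bars counts.\<close>

lemma card_exponents_le:
  "finite {a :: nat ^ 'n::finite. (\<Sum>i\<in>UNIV. a $ i) = m} \<and>
   card {a :: nat ^ 'n. (\<Sum>i\<in>UNIV. a $ i) = m} \<le> (CARD('n) + m - 1) choose m"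
proof -
  obtain xs :: "'n list" where xs: "set xs = UNIV" "distinct xs"
    using finite_distinct_list[of "UNIV :: 'n set"] by auto
  let ?A = "{a :: nat ^ 'n. (\<Sum>i\<in>UNIV. a $ i) = m}"
  let ?L = "{l :: nat list. length l = CARD('n) \<and> sum_list l = m}"
  let ?h = "\<lambda>a :: nat ^ 'n. map (($) a) xs"
  have "inj ?h"
    using xs by (auto simp: inj_def vec_eq_iff)
  then have inj: "inj_on ?h ?A"
    by (rule inj_on_subset) simp
  have len: "length xs = CARD('n)"
    using xs distinct_card by metis
  have img: "?h ` ?A \<subseteq> ?L"
    using xs len by (auto simp: sum_list_distinct_conv_sum_set)
  have fin: "finite ?L"
  proof (rule finite_subset)
    show "?L \<subseteq> {l. set l \<subseteq> {..m} \<and> length l = CARD('n)}"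
      by (auto dest: member_le_sum_list)
  qed (simp add: finite_lists_length_eq)
  have "card ?A \<le> card ?L"
    by (rule card_inj_on_le[OF inj img fin])
  also have "\<dots> = (CARD('n) + m - 1) choose m"
    by (simp add: card_length_sum_list add.commute)
  finally show ?thesis
    using inj_on_finite[OF inj img fin] by simp
qed

definition even_degree_exponents :: "nat \<Rightarrow> (nat ^ 'n::finite) set" where
  "even_degree_exponents d = (\<Union>j\<le>d. {a. (\<Sum>i\<in>UNIV. a $ i) = 2 * j})"

lemma in_even_degree_exponents:
  "a \<in> even_degree_exponents d \<longleftrightarrow> even (\<Sum>i\<in>UNIV. a $ i) \<and> (\<Sum>i\<in>UNIV. a $ i) \<le> 2 * d"
  by (auto simp: even_degree_exponents_def elim!: evenE)

lemma finite_even_degree_exponents: "finite (even_degree_exponents d)"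
  by (simp add: even_degree_exponents_def card_exponents_le)

lemma card_even_degree_exponents_le:
  "card (even_degree_exponents d :: (nat ^ 'n::finite) set)
    \<le> (\<Sum>i = 0..d. (CARD('n) + 2 * i - 1) choose (2 * i))"
proof -
  have "card (even_degree_exponents d :: (nat ^ 'n) set)
      \<le> (\<Sum>j\<le>d. card {a :: nat ^ 'n. (\<Sum>i\<in>UNIV. a $ i) = 2 * j})"
    unfolding even_degree_exponents_def by (rule card_UN_le) simp
  also have "\<dots> \<le> (\<Sum>i\<le>d. (CARD('n) + 2 * i - 1) choose (2 * i))"
    by (intro sum_mono conjunct2[OF card_exponents_le])
  finally show ?thesis
    by (simp add: atLeast0AtMost)
qed

lemma (in half_sign_vectors) inj_const_exponents:
  assumes "even CARD('n)"
  obtains h :: "nat ^ 'n \<Rightarrow> nat ^ 'n"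
  where "inj_on h (const_exponents \<Gamma> \<inter> {a. (\<Sum>i\<in>UNIV. a $ i) \<le> 2 * d})"
    "h ` (const_exponents \<Gamma> \<inter> {a. (\<Sum>i\<in>UNIV. a $ i) \<le> 2 * d}) \<subseteq> even_degree_exponents d"
proof (cases "\<exists>b\<in>const_exponents \<Gamma>. odd (\<Sum>i\<in>UNIV. b $ i)")
  case False
  show thesis
    by (rule that[of id]) (use False in \<open>auto simp: in_even_degree_exponents\<close>)
next
  case True
  let ?K = "const_exponents \<Gamma> \<inter> {a. (\<Sum>i\<in>UNIV. a $ i) \<le> 2 * d}"
  from True obtain b where b: "b \<in> const_exponents \<Gamma>" and bodd: "odd (\<Sum>i\<in>UNIV. b $ i)"
    by blast
  from bodd obtain i where i: "odd (b $ i)"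
    by (metis dvd_sum)
  \<comment> \<open>An odd sum has an odd number of odd terms, so with an even number of variables
    not every entry of \<open>b\<close> is odd.\<close>
  have "odd (card {k. odd (b $ k)})"
    using bodd by (simp add: even_sum_iff)
  with assms have "{k. odd (b $ k)} \<noteq> UNIV"
    by auto
  then obtain k where k: "even (b $ k)"
    by blast
  have parity: "odd (a $ j) \<longleftrightarrow> odd (b $ j)" if "a \<in> const_exponents \<Gamma>" "odd (a $ l)" for a j l
    using odd_transfer[OF that b] odd_transfer[OF b i that(1)] by blast
  \<comment> \<open>Even exponents already have even degree and stay put; the others share the odd
    degree parity of \<open>b\<close>, which raising entry \<open>k\<close> repairs.\<close>
  define h where "h a = (if \<forall>j. even (a $ j) then a else a + axis k 1)" for a :: "nat ^ 'n"
  have even_k: "even (a $ k)" if "a \<in> const_exponents \<Gamma>" for a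
    using odd_transfer[OF b i that] k by blast
  have inj: "inj_on h ?K"
  proof (rule inj_onI)
    fix x y
    assume "x \<in> ?K" "y \<in> ?K" and eq: "h x = h y"
    then have ev: "even (x $ k)" "even (y $ k)"
      using even_k by blast+
    have "h x $ k = h y $ k"
      using eq by simp
    \<comment> \<open>Entry \<open>k\<close> is even before \<open>h\<close> acts, so its parity
      afterwards reveals which branch of \<open>h\<close> was taken.\<close>
    then have "(\<forall>j. even (x $ j)) \<longleftrightarrow> (\<forall>j. even (y $ j))"
      using ev by (auto simp: h_def axis_def split: if_splits) (metis even_Suc)+
    then show "x = y"
      using eq by (auto simp: h_def split: if_splits)
  qed
  have img: "h a \<in> even_degree_exponents d" if "a \<in> ?K" for a
  proof (cases "\<forall>j. even (a $ j)")
    case True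
    then show ?thesis
      using that by (auto simp: h_def in_even_degree_exponents intro: dvd_sum)
  next
    case False
    then have "{j. odd (a $ j)} = {j. odd (b $ j)}"
      using parity that by blast
    then have "odd (\<Sum>i\<in>UNIV. a $ i)"
      using bodd by (simp add: even_sum_iff)
    \<comment> \<open>An odd degree cannot equal \<open>2 * d\<close>, which leaves room for the
      added 1.\<close>
    moreover from this have "(\<Sum>i\<in>UNIV. a $ i) < 2 * d"
      using that by (metis Int_iff dvd_triv_left le_neq_implies_less mem_Collect_eq)
    moreover have "(\<Sum>i\<in>UNIV. (axis k 1 :: nat ^ 'n) $ i) = 1"
      by (simp add: axis_def)
    ultimately show ?thesis
      using False by (auto simp: h_def in_even_degree_exponents sum.distrib)
  qed
  show thesis
    by (rule that[OF inj]) (use img in blast)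
qed

section \<open>The dimension bound\<close>

text \<open>The span of the monomials from \<open>K\<close> is a subspace containing
  \<open>S\<close>, hence also its affine hull and all differences of points in that hull.\<close>

lemma affine_hull_dim_le_card_keys:
  fixes S :: "('a \<Rightarrow>\<^sub>0 real) set"
  assumes "finite K" "\<And>p. p \<in> S \<Longrightarrow> Poly_Mapping.keys p \<subseteq> K"
  shows "affine_hull_dim S \<le> card K"
proof -
  let ?B = "(\<lambda>a. Poly_Mapping.single a (1::real)) ` K"
  have "p \<in> span ?B" if "p \<in> S" for p
  proof -
    have "p = (\<Sum>a\<in>K. Poly_Mapping.lookup p a *\<^sub>R Poly_Mapping.single a 1)"
    proof (rule poly_mapping_eqI)
      fix a
      have "a \<notin> K \<Longrightarrow> Poly_Mapping.lookup p a = 0"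
        using assms(2)[OF that] by (auto simp: in_keys_iff)
      then show "Poly_Mapping.lookup p a
          = Poly_Mapping.lookup (\<Sum>a\<in>K. Poly_Mapping.lookup p a *\<^sub>R Poly_Mapping.single a 1) a"
        using assms(1) by (auto simp: lookup_sum lookup_single when_def if_distrib cong: if_cong)
    qed
    also have "\<dots> \<in> span ?B"
      by (intro span_sum span_scale span_base) auto
    finally show ?thesis .
  qed
  then have "affine hull S \<subseteq> span ?B"
    by (intro hull_minimal subspace_imp_affine subspace_span) auto
  then have "{x - y | x y. x \<in> affine hull S \<and> y \<in> affine hull S} \<subseteq> span ?B"
    using span_diff by blast
  then have "affine_hull_dim S \<le> card ?B"
    unfolding affine_hull_dim_def using assms(1) by (intro real_vector.dim_le_card) auto
  also have "\<dots> \<le> card K"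
    by (rule card_image_le[OF assms(1)])
  finally show ?thesis .
qed

theorem proposition5p4:
  fixes \<Gamma> :: "(real ^ 'n::finite) set" and d :: nat
  assumes "even CARD('n)"
    and "1 \<le> d"
    and "\<Gamma> \<subseteq> {s. \<forall>i. s $ i \<in> {1, -1}}"
    and "card \<Gamma> = 2 ^ (CARD('n) - 1)"
  shows "affine_hull_dim (sonc_face (2 * d) \<Gamma>)
      \<le> (\<Sum>i = 0..d. (CARD('n) + 2 * i - 1) choose (2 * i))"
proof -
  interpret half_sign_vectors \<Gamma>
    using assms by unfold_locales (auto simp: sign_vectors_def)
  let ?K = "const_exponents \<Gamma> \<inter> {a. (\<Sum>i\<in>UNIV. a $ i) \<le> 2 * d}"
  obtain h :: "nat ^ 'n \<Rightarrow> nat ^ 'n"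
    where h: "inj_on h ?K" "h ` ?K \<subseteq> even_degree_exponents d"
    using inj_const_exponents[OF assms(1)] by blast
  \<comment> \<open>Finiteness of \<open>?K\<close> is inherited through the injection
    \<open>h\<close> into a finite set.\<close>
  have "affine_hull_dim (sonc_face (2 * d) \<Gamma>) \<le> card ?K"
    using inj_on_finite[OF h finite_even_degree_exponents] keys_face
    by (intro affine_hull_dim_le_card_keys) auto
  also have "\<dots> \<le> card (even_degree_exponents d :: (nat ^ 'n) set)"
    by (rule card_inj_on_le[OF h finite_even_degree_exponents])
  also have "\<dots> \<le> (\<Sum>i = 0..d. (CARD('n) + 2 * i - 1) choose (2 * i))"
    by (rule card_even_degree_exponents_le)
  finally show ?thesis .
qed

end
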